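(* Let $\mathcal{A}$ be a configuration of type $(m,1^n)$ in $\mathbb{C}^2$, with vectors $\alpha_0,\dots,\alpha_n$ and multiplicities $m_0=m$, $m_1=\dots=m_n=1$. Suppose that for all $j=0,\dots,n$ $$\sum_{i=0,\ i\neq j}^n\frac{m_i(\alpha_j,\alpha_i)}{(\alpha_i,x)}\Big|_{\Pi_j}=0 .$$ Then for all $j=0,\dots,n$ $$\sum_{i=0,\ i\neq j}^n\frac{m_i(m_i+1)(\alpha_i,\alpha_i)(\alpha_j,\alpha_i)}{(\alpha_i,x)^{3}}\Big|_{\Pi_j}=0 .$$
   Context: A configuration of type $(m,1^n)$ ($m,n\ge1$ integers) consists of $n+1$ pairwise non-collinear vectors $\alpha_0,\dots,\alpha_n\in\mathbb{C}^2$ with multiplicities $m_0=m$, $m_i=1$ for $1\le i\le n$. Here $(u,v)=u_1v_1+u_2v_2$ is the standard complex bilinear form, all vectors are assumed non-isotropic ($(\alpha_i,\alpha_i)\ne0$), and $\Pi_j=\{x\in\mathbb{C}^2:(\alpha_j,x)=0\}$; the identities are understood for non-zero $x\in\Pi_j$. *)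

theory Defs
  imports "HOL-Analysis.Analysis"
begin

text \<open>The complex bilinear form; unlike the library's \<^const>\<open>inner\<close> it is complex valued and
  involves no conjugation.\<close>
definition cform :: "complex ^ 2 \<Rightarrow> complex ^ 2 \<Rightarrow> complex" where
  "cform u v = u $ 1 * v $ 1 + u $ 2 * v $ 2"

text \<open>Collinearity of two vectors over the complex numbers (the library's \<^const>\<open>collinear\<close> is
  affine and over the reals).\<close>
definition ccollinear :: "complex ^ 2 \<Rightarrow> complex ^ 2 \<Rightarrow> bool" where
  "ccollinear u v \<longleftrightarrow> (\<exists>c. u = c *s v \<or> v = c *s u)"

definition hyperplane :: "complex ^ 2 \<Rightarrow> (complex ^ 2) set" where
  "hyperplane a = {x. cform a x = 0}"

text \<open>Configurations of type $(m, 1^n)$; only the values of \<open>\<alpha>\<close> and \<open>\<mu>\<close> (the multiplicities)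
  at indices up to \<open>n\<close> matter.\<close>
definition configuration_m1n ::
  "nat \<Rightarrow> nat \<Rightarrow> (nat \<Rightarrow> complex ^ 2) \<Rightarrow> (nat \<Rightarrow> nat) \<Rightarrow> bool" where
  "configuration_m1n m n \<alpha> \<mu> \<longleftrightarrow>
     m \<ge> 1 \<and> n \<ge> 1 \<and>
     (\<forall>i\<le>n. \<forall>j\<le>n. i \<noteq> j \<longrightarrow> \<not> ccollinear (\<alpha> i) (\<alpha> j)) \<and>
     (\<forall>i\<le>n. cform (\<alpha> i) (\<alpha> i) \<noteq> 0) \<and>
     \<mu> 0 = m \<and> (\<forall>i\<in>{1..n}. \<mu> i = 1)"

end

theory Submission
  imports Defs
begin

text \<open>Up to normalisation \<open>\<alpha>\<^sub>i\<close> is a unit vector at angle \<open>\<phi>\<^sub>i\<close>, and with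
  \<open>c\<^sub>i\<^sub>j = cot (\<phi>\<^sub>i - \<phi>\<^sub>j)\<close> the hypothesis says that the sum of \<open>m\<^sub>i c\<^sub>i\<^sub>j\<close> over \<open>i\<close> vanishes for
  every \<open>j\<close>, while the claim is the vanishing of the sum of
  \<open>m\<^sub>i (m\<^sub>i + 1) (c\<^sub>i\<^sub>j + c\<^sub>i\<^sub>j\<^sup>3)\<close>. Fix \<open>j\<close>, multiply the hypothesis at \<open>i\<close> by \<open>m\<^sub>i c\<^sub>i\<^sub>j\<^sup>2\<close>, sum over
  \<open>i \<noteq> j\<close> and symmetrise: the addition theorem for the cotangent makes the summands polynomial,
  and the hypothesis at \<open>j\<close> leaves only diagonal terms. For arbitrary multiplicities this yields
  that the sum of \<open>m\<^sub>i (m\<^sub>i + m\<^sub>j) (c\<^sub>i\<^sub>j + c\<^sub>i\<^sub>j\<^sup>3)\<close> vanishes. For \<open>j \<noteq> 0\<close> this is the claim because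
  \<open>m\<^sub>j = 1\<close>; for \<open>j = 0\<close> the factor \<open>m\<^sub>i + m\<^sub>j = 1 + m\<close> is constant and cancels.\<close>

lemma balanced_cotangents_cubic:
  fixes c :: "'i \<Rightarrow> 'i \<Rightarrow> 'a::field_char_0" and w :: "'i \<Rightarrow> 'a"
  assumes "finite I" and "j \<in> I"
    and antisym: "\<And>i k. c k i = - c i k"
    and addition: "\<And>i k. i \<in> I - {j} \<Longrightarrow> k \<in> I - {j} \<Longrightarrow> i \<noteq> k \<Longrightarrow>
                     c k i * (c i j - c k j) = 1 + c i j * c k j"
    and balanced: "\<And>i. i \<in> I \<Longrightarrow> (\<Sum>k\<in>I - {i}. w k * c k i) = 0"
  shows "(\<Sum>i\<in>I - {j}. w i * (w i + w j) * (c i j + c i j ^ 3)) = 0"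
proof -
  define A where "A = I - {j}"
  define u where "u i = c i j" for i
  have finA: "finite A" using assms(1) by (simp add: A_def)
  have diag: "c i i = 0" for i
  proof -
    have "2 * c i i = 0"
      unfolding mult_2 using antisym[of i i] by (rule eq_neg_iff_add_eq_0[THEN iffD1])
    then show ?thesis by simp
  qed
  have s1: "(\<Sum>k\<in>A. w k * u k) = 0"
    using balanced[OF assms(2)] by (simp add: A_def u_def)
  \<comment> \<open>The hypothesis at \<open>i\<close> with its \<open>k = j\<close> term moved to
    the right; the term \<open>k = i\<close> may be included since \<open>c i i = 0\<close>.\<close>
  have bal: "(\<Sum>k\<in>A. w k * c k i) = w j * u i" if "i \<in> A" for i
  proof -
    have "i \<in> I" using that by (simp add: A_def)
    have "(\<Sum>k\<in>I. w k * c k i) = 0"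
      using balanced[OF \<open>i \<in> I\<close>] assms(1) \<open>i \<in> I\<close> by (simp add: sum.remove diag)
    moreover have "(\<Sum>k\<in>I. w k * c k i) = w j * c j i + (\<Sum>k\<in>A. w k * c k i)"
      unfolding A_def by (rule sum.remove) (use assms(1,2) in auto)
    ultimately show ?thesis
      using antisym[of j i] by (simp add: u_def)
  qed
  define D where "D = (\<Sum>i\<in>A. \<Sum>k\<in>A. w i * w k * c k i * u i ^ 2)"
  have D1: "D = (\<Sum>i\<in>A. w i * w j * u i ^ 3)"
    unfolding D_def
  proof (rule sum.cong[OF refl])
    fix i assume "i \<in> A"
    have "(\<Sum>k\<in>A. w i * w k * c k i * u i ^ 2) = w i * u i ^ 2 * (\<Sum>k\<in>A. w k * c k i)"
      by (simp add: sum_distrib_left mult_ac)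
    then show "(\<Sum>k\<in>A. w i * w k * c k i * u i ^ 2) = w i * w j * u i ^ 3"
      using bal[OF \<open>i \<in> A\<close>] by (simp add: power2_eq_square power3_eq_cube)
  qed
  have D2: "D = (\<Sum>i\<in>A. \<Sum>k\<in>A. w i * w k * c i k * u k ^ 2)"
    unfolding D_def by (subst sum.swap) (simp add: mult_ac)
  \<comment> \<open>Off the diagonal, the addition theorem turns the left side into
    \<open>w i * w k * c k i * (u i ^ 2 - u k ^ 2)\<close>, and antisymmetry splits it. On the
    diagonal the cotangents vanish and the polynomial itself remains as the correction.\<close>
  have pointwise: "w i * w k * (1 + u i * u k) * (u i + u k)
      = w i * w k * c k i * u i ^ 2 + w i * w k * c i k * u k ^ 2
        + (if k = i then 2 * w i ^ 2 * (u i + u i ^ 3) else 0)"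
    if "i \<in> A" "k \<in> A" for i k
  proof (cases "k = i")
    case True
    then show ?thesis by (simp add: diag power2_eq_square power3_eq_cube algebra_simps)
  next
    case False
    have "c k i * (u i - u k) = 1 + u i * u k"
      using addition[of i k] that False by (auto simp: A_def u_def)
    then have "w i * w k * (1 + u i * u k) * (u i + u k)
        = w i * w k * (c k i * (u i - u k)) * (u i + u k)" by simp
    then show ?thesis
      using False antisym[of i k] by (simp add: power2_eq_square algebra_simps)
  qed
  \<comment> \<open>After expansion each of the four double sums factors, and one factor is the sum
    \<open>s1\<close>.\<close>
  have "(\<Sum>i\<in>A. \<Sum>k\<in>A. w i * w k * (1 + u i * u k) * (u i + u k))
      = (\<Sum>i\<in>A. \<Sum>k\<in>A. (w i * u i) * w k + w i * (w k * u k)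
          + (w i * u i ^ 2) * (w k * u k) + (w i * u i) * (w k * u k ^ 2))"
    by (intro sum.cong refl) (simp add: power2_eq_square algebra_simps)
  also have "\<dots> = 0"
    by (simp add: sum.distrib s1 flip: sum_product)
  finally have "0 = D + D + (\<Sum>i\<in>A. 2 * w i ^ 2 * (u i + u i ^ 3))"
    by (subst (asm) sum.cong[OF refl sum.cong[OF refl pointwise]])
       (simp_all add: sum.distrib finA flip: D_def D2)
  then have "2 * (D + (\<Sum>i\<in>A. w i ^ 2 * (u i + u i ^ 3))) = 0"
    by (simp add: sum_distrib_left mult_ac distrib_left)
  then have *: "D + (\<Sum>i\<in>A. w i ^ 2 * (u i + u i ^ 3)) = 0"
    by (simp only: mult_eq_0_iff zero_neq_numeral[symmetric] simp_thms)
  have "(\<Sum>i\<in>A. w i * (w i + w j) * (u i + u i ^ 3))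
      = D + (\<Sum>i\<in>A. w i ^ 2 * (u i + u i ^ 3)) + w j * (\<Sum>i\<in>A. w i * u i)"
    unfolding D1 by (simp add: sum_distrib_left flip: sum.distrib)
      (simp add: power2_eq_square algebra_simps)
  then show ?thesis
    using * s1 by (simp add: A_def u_def)
qed

definition cdet :: "complex ^ 2 \<Rightarrow> complex ^ 2 \<Rightarrow> complex" where
  "cdet u v = u $ 1 * v $ 2 - u $ 2 * v $ 1"

text \<open>For non-isotropic vectors this is the cotangent of the complex angle from
  \<open>v\<close> to \<open>u\<close>, free of normalisation. Division by zero gives 0 on collinear
  pairs, so antisymmetry holds without side conditions.\<close>

definition ccot :: "complex ^ 2 \<Rightarrow> complex ^ 2 \<Rightarrow> complex" where
  "ccot u v = cform u v / cdet v u"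

lemma ccot_antisym: "ccot u v = - ccot v u"
proof -
  have "cdet v u = - cdet u v" "cform u v = cform v u"
    by (simp_all add: cdet_def cform_def)
  then show ?thesis by (simp add: ccot_def)
qed

lemma ccot_diff:
  assumes "cdet a v \<noteq> 0" "cdet a u \<noteq> 0" "cdet v u \<noteq> 0"
  shows "ccot u v * (ccot v a - ccot u a) = 1 + ccot v a * ccot u a"
  using assms unfolding ccot_def
  by (simp add: divide_simps) (simp add: cdet_def cform_def; algebra)

text \<open>The unnormalised form of cos^2 + sin^2 = 1; it evaluates the factor 1 + cot^2 in the
  cubic sums.\<close>

lemma lagrange_identity: "cform u u * cform v v = cform u v ^ 2 + cdet v u ^ 2"
  by (simp add: cform_def cdet_def power2_eq_square algebra_simps)

lemma cdet_nonzero: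
  assumes "\<not> ccollinear u v" "cform u u \<noteq> 0"
  shows "cdet u v \<noteq> 0"
proof
  assume "cdet u v = 0"
  \<comment> \<open>These are the coordinates of \<open>v\<close> in the orthogonal basis formed by
    \<open>u\<close> and its rotation by a right angle, a basis because \<open>u\<close> is
    non-isotropic.\<close>
  moreover have "cform u u * v $ 1 = cform u v * u $ 1 - cdet u v * u $ 2"
    "cform u u * v $ 2 = cform u v * u $ 2 + cdet u v * u $ 1"
    by (simp_all add: cform_def cdet_def algebra_simps)
  ultimately have "v = (cform u v / cform u u) *s u"
    using assms(2) by (simp add: vec_eq_iff forall_2 field_simps)
  with assms(1) show False by (auto simp: ccollinear_def)
qed

lemma hyperplane_eq_span:
  assumes "cform a a \<noteq> 0"
  shows "hyperplane a = range (\<lambda>s. s *s vector [- a $ 2, a $ 1])"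
proof
  show "range (\<lambda>s. s *s vector [- a $ 2, a $ 1]) \<subseteq> hyperplane a"
    by (auto simp: hyperplane_def cform_def)
  show "hyperplane a \<subseteq> range (\<lambda>s. s *s vector [- a $ 2, a $ 1])"
  proof
    fix x assume "x \<in> hyperplane a"
    moreover have "cform a a * x $ 1 = cform a x * a $ 1 - cdet a x * a $ 2"
      "cform a a * x $ 2 = cform a x * a $ 2 + cdet a x * a $ 1"
      by (simp_all add: cform_def cdet_def algebra_simps)
    ultimately have "x = (cdet a x / cform a a) *s vector [- a $ 2, a $ 1]"
      using assms by (simp add: hyperplane_def vec_eq_iff forall_2 field_simps)
    then show "x \<in> range (\<lambda>s. s *s vector [- a $ 2, a $ 1])" by blast
  qed
qed

lemma cform_rotated: "cform u (s *s vector [- a $ 2, a $ 1]) = s * cdet a u"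
  by (simp add: cform_def cdet_def algebra_simps)

theorem proposition2p13:
  fixes m n :: nat and \<alpha> :: "nat \<Rightarrow> complex ^ 2" and \<mu> :: "nat \<Rightarrow> nat"
  assumes "configuration_m1n m n \<alpha> \<mu>"
    and "\<forall>j\<le>n. \<forall>x \<in> hyperplane (\<alpha> j) - {0}.
           (\<Sum>i \<in> {0..n} - {j}. of_nat (\<mu> i) * cform (\<alpha> j) (\<alpha> i) / cform (\<alpha> i) x) = 0"
  shows "\<forall>j\<le>n. \<forall>x \<in> hyperplane (\<alpha> j) - {0}.
           (\<Sum>i \<in> {0..n} - {j}. of_nat (\<mu> i * (\<mu> i + 1)) * cform (\<alpha> i) (\<alpha> i) * cform (\<alpha> j) (\<alpha> i)
              / cform (\<alpha> i) x ^ 3) = 0"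
proof (intro allI impI ballI)
  fix j x assume j: "j \<le> n" and x: "x \<in> hyperplane (\<alpha> j) - {0}"
  have noncol: "\<not> ccollinear (\<alpha> i) (\<alpha> k)" if "i \<le> n" "k \<le> n" "i \<noteq> k" for i k
    using assms(1) that by (simp add: configuration_m1n_def)
  have aniso: "cform (\<alpha> i) (\<alpha> i) \<noteq> 0" if "i \<le> n" for i
    using assms(1) that by (simp add: configuration_m1n_def)
  have mult: "\<mu> i = 1" if "i \<in> {1..n}" for i
    using assms(1) that by (simp add: configuration_m1n_def)
  have det: "cdet (\<alpha> i) (\<alpha> k) \<noteq> 0" if "i \<le> n" "k \<le> n" "i \<noteq> k" for i k
    using noncol[OF that] aniso[OF that(1)] by (rule cdet_nonzero)
  define c where "c i k = ccot (\<alpha> i) (\<alpha> k)" for i k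
  have balanced: "(\<Sum>k\<in>{0..n} - {i}. of_nat (\<mu> k) * c k i) = 0" if "i \<in> {0..n}" for i
  proof -
    \<comment> \<open>At the rotated \<open>\<alpha> i\<close> every denominator
      \<open>cform (\<alpha> k) y\<close> becomes \<open>cdet (\<alpha> i) (\<alpha> k)\<close>, so
      the quotients are exactly cotangents.\<close>
    define y :: "complex ^ 2" where "y = 1 *s vector [- \<alpha> i $ 2, \<alpha> i $ 1]"
    have "i \<le> n" using that by simp
    have "y \<in> hyperplane (\<alpha> i)"
      unfolding hyperplane_eq_span[OF aniso[OF \<open>i \<le> n\<close>]] y_def by (rule rangeI)
    moreover have "y \<noteq> 0"
      using aniso[OF \<open>i \<le> n\<close>] by (auto simp: y_def vec_eq_iff forall_2 cform_def)
    ultimately have "(\<Sum>k\<in>{0..n} - {i}. of_nat (\<mu> k) * cform (\<alpha> i) (\<alpha> k) / cform (\<alpha> k) y) = 0"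
      using assms(2) \<open>i \<le> n\<close> by blast
    then show ?thesis
      unfolding y_def cform_rotated by (simp add: c_def ccot_def cform_def mult.commute)
  qed
  have cubic: "(\<Sum>i\<in>{0..n} - {j}. of_nat (\<mu> i) * (of_nat (\<mu> i) + of_nat (\<mu> j))
                 * (c i j + c i j ^ 3)) = 0"
  proof (rule balanced_cotangents_cubic)
    show "c k i = - c i k" for i k
      unfolding c_def by (rule ccot_antisym)
    show "c k i * (c i j - c k j) = 1 + c i j * c k j"
      if "i \<in> {0..n} - {j}" "k \<in> {0..n} - {j}" "i \<noteq> k" for i k
      unfolding c_def by (rule ccot_diff) (use that j in \<open>simp_all add: det\<close>)
  qed (use j balanced in auto)
  have cubic': "(\<Sum>i\<in>{0..n} - {j}. of_nat (\<mu> i * (\<mu> i + 1)) * (c i j + c i j ^ 3)) = 0"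
  proof (cases "j = 0")
    case True
    have "(1 + of_nat (\<mu> j)) * (\<Sum>i\<in>{0..n} - {j}. c i j + c i j ^ 3) = 0"
      unfolding sum_distrib_left
      by (rule trans[OF sum.cong cubic]) (use True mult in auto)
    moreover have "1 + of_nat (\<mu> j) \<noteq> (0::complex)"
      by (metis of_nat_Suc of_nat_eq_0_iff nat.distinct(1))
    \<comment> \<open>The 2 is \<open>\<mu> i * (\<mu> i + 1)\<close> for the indices
      \<open>i\<close> other than 0.\<close>
    ultimately have "2 * (\<Sum>i\<in>{0..n} - {j}. c i j + c i j ^ 3) = 0"
      by simp
    then show ?thesis
      unfolding sum_distrib_left
      by (rule trans[OF sum.cong, rotated 2]) (use True mult in auto)
  next
    case False
    then have "\<mu> j = 1" using j mult by simp
    with cubic show ?thesis by (simp add: distrib_left add.commute)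
  qed
  obtain s where s: "x = s *s vector [- \<alpha> j $ 2, \<alpha> j $ 1]"
    using x unfolding hyperplane_eq_span[OF aniso[OF j]] by blast
  have "s \<noteq> 0" using s x by auto
  \<comment> \<open>By the Lagrange identity, c + c^3 = c (1 + c^2) yields the required numerator up
    to a factor that does not depend on \<open>i\<close>.\<close>
  have pointwise: "of_nat (\<mu> i * (\<mu> i + 1)) * cform (\<alpha> i) (\<alpha> i) * cform (\<alpha> j) (\<alpha> i) / cform (\<alpha> i) x ^ 3
      = 1 / (s ^ 3 * cform (\<alpha> j) (\<alpha> j)) * (of_nat (\<mu> i * (\<mu> i + 1)) * (c i j + c i j ^ 3))"
    if "i \<in> {0..n} - {j}" for i
  proof -
    define d where "d = cdet (\<alpha> j) (\<alpha> i)"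
    have "d \<noteq> 0" unfolding d_def using that j by (intro det) auto
    have "cform (\<alpha> j) (\<alpha> i) = cform (\<alpha> i) (\<alpha> j)" by (simp add: cform_def)
    moreover have "c i j + c i j ^ 3 = cform (\<alpha> i) (\<alpha> j) * (cform (\<alpha> i) (\<alpha> j) ^ 2 + d ^ 2) / d ^ 3"
      using \<open>d \<noteq> 0\<close> unfolding c_def ccot_def d_def[symmetric]
      by (simp add: field_simps power2_eq_square power3_eq_cube)
    then have "c i j + c i j ^ 3
        = cform (\<alpha> i) (\<alpha> j) * (cform (\<alpha> i) (\<alpha> i) * cform (\<alpha> j) (\<alpha> j)) / d ^ 3"
      by (simp only: lagrange_identity[of "\<alpha> i" "\<alpha> j", folded d_def])
    ultimately show ?thesis
      unfolding s cform_rotated d_def[symmetric]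
      using aniso[OF j] by (simp add: power_mult_distrib)
  qed
  show "(\<Sum>i \<in> {0..n} - {j}. of_nat (\<mu> i * (\<mu> i + 1)) * cform (\<alpha> i) (\<alpha> i) * cform (\<alpha> j) (\<alpha> i)
              / cform (\<alpha> i) x ^ 3) = 0"
    by (subst sum.cong[OF refl pointwise]) (simp_all only: sum_distrib_left[symmetric] cubic' mult_zero_right)
qed

end
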